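(* Let $n\ge 1$ and let $\alpha_1,\dots,\alpha_n$ be real numbers with $0\le\alpha_i\le 1$ for $i=1,\dots,n$ and $\sum_{i=1}^n\alpha_i=1$. Let $X_1,\dots,X_n$ be any random variables with $\mathrm{Var}(X_i)<+\infty$ for $i=1,\dots,n$. Then $$\mathrm{Var}\Big(\sum_{i=1}^n\alpha_iX_i\Big)\le\sum_{i=1}^n\alpha_i\,\mathrm{Var}(X_i).$$
   Context: Random variables are real-valued, defined on a common probability space, with finite expectation and variance; no independence or uncorrelatedness is assumed. $\mathrm{Var}$ denotes variance. *)

theory Defs
  imports "HOL-Probability.Probability"
begin

end

theory Submission
  imports Defs
begin

text \<open>With weights summing to 1, the square of the averaged deviation is at most the average
  of the squared deviations at each \<open>\<omega>\<close>. Covariances are never expanded, so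
  dependence between the variables is harmless.\<close>

text \<open>Centering commutes with the weighted sum, so the inequality is the expectation of the pointwise
  Jensen inequality for the square, applied to the centered variables.\<close>

theorem theorem1:
  fixes M :: "'a measure"
    and n :: nat
    and \<alpha> :: "nat \<Rightarrow> real"
    and X :: "nat \<Rightarrow> 'a \<Rightarrow> real"
  assumes "prob_space M"
    and "n \<ge> 1"
    and "\<And>i. i \<in> {1..n} \<Longrightarrow> 0 \<le> \<alpha> i \<and> \<alpha> i \<le> 1"
    and "(\<Sum>i=1..n. \<alpha> i) = 1"
    and "\<And>i. i \<in> {1..n} \<Longrightarrow> X i \<in> borel_measurable M"
    and "\<And>i. i \<in> {1..n} \<Longrightarrow> integrable M (X i)"
    and "\<And>i. i \<in> {1..n} \<Longrightarrow>
           integrable M (\<lambda>\<omega>. (X i \<omega> - prob_space.expectation M (X i))\<^sup>2)"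
  shows "prob_space.variance M (\<lambda>\<omega>. \<Sum>i=1..n. \<alpha> i * X i \<omega>)
           \<le> (\<Sum>i=1..n. \<alpha> i * prob_space.variance M (X i))"
proof -
  interpret prob_space M by fact
  define Y where "Y i \<omega> = X i \<omega> - expectation (X i)" for i \<omega>
  have Y2: "integrable M (\<lambda>\<omega>. (Y i \<omega>)\<^sup>2)" if "i \<in> {1..n}" for i
    using assms(7)[OF that] by (simp add: Y_def)
  have centered: "(\<Sum>i=1..n. \<alpha> i * X i \<omega>) - expectation (\<lambda>\<omega>. \<Sum>i=1..n. \<alpha> i * X i \<omega>)
      = (\<Sum>i=1..n. \<alpha> i * Y i \<omega>)" for \<omega>
    \<comment> \<open>Integrability of each \<open>X i\<close> is what lets the expectation pass
      through the sum.\<close>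
    using assms(6) by (simp add: Y_def right_diff_distrib sum_subtractf)
  have jensen: "(\<Sum>i=1..n. \<alpha> i * Y i \<omega>)\<^sup>2 \<le> (\<Sum>i=1..n. \<alpha> i * (Y i \<omega>)\<^sup>2)" for \<omega>
    using convex_on_sum[OF _ _ convex_power2 assms(4), of "\<lambda>i. Y i \<omega>"] assms(2,3) by auto
  have "variance (\<lambda>\<omega>. \<Sum>i=1..n. \<alpha> i * X i \<omega>) = expectation (\<lambda>\<omega>. (\<Sum>i=1..n. \<alpha> i * Y i \<omega>)\<^sup>2)"
    by (simp only: centered)
  \<comment> \<open>\<open>integral_mono'\<close> asks integrability only of the larger, nonnegative
    side, so the cross terms \<open>Y i * Y j\<close> need no separate integrability
    argument.\<close>
  also have "\<dots> \<le> expectation (\<lambda>\<omega>. \<Sum>i=1..n. \<alpha> i * (Y i \<omega>)\<^sup>2)"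
    using Y2 assms(3) jensen by (intro integral_mono') (auto intro!: sum_nonneg)
  also have "\<dots> = (\<Sum>i=1..n. \<alpha> i * variance (X i))"
    using Y2 by (simp add: Y_def)
  finally show ?thesis .
qed

end
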